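(* Let $G$ be a graph that is not bipartite, and let $B(G)$ be its bipartite double cover. Then $$c(G)\le c(B(G))\le 2c(G).$$
   Context: All graphs are finite, simple, undirected and connected. The bipartite double cover $B(G)$ of a non-bipartite graph $G$ is the categorical product $G\times K_2$: its vertex set is $\{(v,a): v\in V(G), a\in V(K_2)\}$, and $(v,a)$ is adjacent to $(v',a')$ exactly when $vv'\in E(G)$ and $aa'\in E(K_2)$ (so $a\ne a'$). Cops and Robbers on a graph $G$: in round $0$ the cops choose vertices to occupy, then the robber chooses a vertex. In each later round the cops move first and then the robber. On a move, each player moves to a neighboring vertex or stays put; any subset of the cops may move. Both sides have complete information. The cops win if after finitely many rounds some cop occupies the robber's vertex; otherwise the robber wins. The cop number $c(G)$ is the minimum number of cops that guarantees a win for the cops. *)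

theory Defs
  imports "Graph_Theory.Graph_Theory"
begin

text \<open>
  A finite simple undirected graph is a \<^locale>\<open>pair_graph\<close>: finite vertex set, symmetric and
  loop-free set of ordered pairs as arcs.
\<close>

definition bipartite :: "'v pair_pre_digraph \<Rightarrow> bool" where
  "bipartite G \<longleftrightarrow>
    (\<exists>U W. pverts G = U \<union> W \<and> U \<inter> W = {} \<and> parcs G \<subseteq> U \<times> W \<union> W \<times> U)"

definition categorical_product ::
  "'v pair_pre_digraph \<Rightarrow> 'w pair_pre_digraph \<Rightarrow> ('v \<times> 'w) pair_pre_digraph" where
  "categorical_product G H =
    \<lparr> pverts = pverts G \<times> pverts H,
      parcs = {((v, a), (v', a')) | v a v' a'. (v, v') \<in> parcs G \<and> (a, a') \<in> parcs H} \<rparr>"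

definition K2 :: "bool pair_pre_digraph" where
  "K2 = \<lparr> pverts = UNIV, parcs = {(a, a'). a \<noteq> a'} \<rparr>"

definition bipartite_double_cover :: "'v pair_pre_digraph \<Rightarrow> ('v \<times> bool) pair_pre_digraph" where
  "bipartite_double_cover G = categorical_product G K2"

lemma pair_graph_bipartite_double_cover:
  assumes "pair_graph G"
  shows "pair_graph (bipartite_double_cover G)"
proof -
  interpret pair_graph G by fact
  let ?B = "bipartite_double_cover G"
  have verts: "pverts ?B = pverts G \<times> UNIV"
    and arcs: "((v, a), (v', a')) \<in> parcs ?B \<longleftrightarrow> (v, v') \<in> parcs G \<and> a \<noteq> a'" for v a v' a'
    by (auto simp: bipartite_double_cover_def categorical_product_def K2_def)
  have sub: "parcs ?B \<subseteq> pverts ?B \<times> pverts ?B"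
    using arcs verts wellformed' by auto
  have fin: "finite (pverts ?B)"
    by (simp add: verts pair_finite_verts)
  have "sym (parcs ?B)"
  proof (rule symI)
    fix x y assume "(x, y) \<in> parcs ?B"
    then show "(y, x) \<in> parcs ?B"
      using arcs symmetric_conv[of "with_proj G"] pair_sym_arcs
      by (cases x; cases y) (auto simp: symmetric_def dest: symD)
  qed
  then show ?thesis
    using sub fin finite_subset[OF sub] arcs
    by unfold_locales (auto simp: symmetric_def)
qed

text \<open>
  Cops and Robbers. The positions of \<open>k\<close> cops form a list of length \<open>k\<close>; several cops may share a
  vertex. A play is a pair of sequences: \<open>C t\<close> and \<open>r t\<close> are the positions of the cops and of the
  robber after their respective moves in round \<open>t\<close>, round \<open>0\<close> being the placement.
\<close>

definition move :: "'v pair_pre_digraph \<Rightarrow> 'v \<Rightarrow> 'v \<Rightarrow> bool" where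
  "move G u v \<longleftrightarrow> v = u \<or> (u, v) \<in> parcs G"

definition legal_cops :: "'v pair_pre_digraph \<Rightarrow> nat \<Rightarrow> (nat \<Rightarrow> 'v list) \<Rightarrow> bool" where
  "legal_cops G k C \<longleftrightarrow>
    length (C 0) = k \<and> set (C 0) \<subseteq> pverts G \<and> (\<forall>t. list_all2 (move G) (C t) (C (Suc t)))"

definition legal_robber :: "'v pair_pre_digraph \<Rightarrow> (nat \<Rightarrow> 'v) \<Rightarrow> bool" where
  "legal_robber G r \<longleftrightarrow> r 0 \<in> pverts G \<and> (\<forall>t. move G (r t) (r (Suc t)))"

text \<open>
  A cop can come to occupy the robber's vertex after the robber's move in round \<open>t\<close>, or after the
  cops' move in round \<open>t + 1\<close>, while the robber is still at \<open>r t\<close>.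
\<close>

definition captured :: "(nat \<Rightarrow> 'v list) \<Rightarrow> (nat \<Rightarrow> 'v) \<Rightarrow> bool" where
  "captured C r \<longleftrightarrow> (\<exists>t. r t \<in> set (C t) \<or> r t \<in> set (C (Suc t)))"

text \<open>
  A cop strategy maps the history of all previous rounds to the cops' next positions.
\<close>

definition follows ::
  "(('v list \<times> 'v) list \<Rightarrow> 'v list) \<Rightarrow> (nat \<Rightarrow> 'v list) \<Rightarrow> (nat \<Rightarrow> 'v) \<Rightarrow> bool" where
  "follows \<sigma> C r \<longleftrightarrow> (\<forall>t. C t = \<sigma> (map (\<lambda>s. (C s, r s)) [0..<t]))"

text \<open>
  Plays are formally continued forever; what happens after the capture is irrelevant, since both
  sides can always legally stay put.
\<close>

definition cops_can_win :: "'v pair_pre_digraph \<Rightarrow> nat \<Rightarrow> bool" where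
  "cops_can_win G k \<longleftrightarrow>
    (\<exists>\<sigma>. \<forall>C r. follows \<sigma> C r \<and> legal_robber G r \<longrightarrow> legal_cops G k C \<and> captured C r)"

definition cop_number :: "'v pair_pre_digraph \<Rightarrow> nat" where
  "cop_number G = (LEAST k. cops_can_win G k)"

text \<open>The minimum is over a nonempty set of numbers: one cop on every vertex suffices.\<close>

lemma cops_can_win_card:
  assumes "finite (pverts G)"
  shows "cops_can_win G (card (pverts G))"
proof -
  obtain vs where vs: "set vs = pverts G" "length vs = card (pverts G)"
    using finite_distinct_list[OF assms] distinct_card by metis
  show ?thesis
    unfolding cops_can_win_def
  proof (intro exI[of _ "\<lambda>_. vs"] allI impI)
    fix C r assume "follows (\<lambda>_. vs) C r \<and> legal_robber G r"
    then have "\<And>t. C t = vs" and "r 0 \<in> pverts G"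
      by (auto simp: follows_def legal_robber_def)
    then show "legal_cops G (card (pverts G)) C \<and> captured C r"
      using vs by (auto simp: legal_cops_def captured_def move_def list_all2_same)
  qed
qed

lemma cops_can_win_cop_number:
  assumes "finite (pverts G)"
  shows "cops_can_win G (cop_number G)"
  unfolding cop_number_def using cops_can_win_card[OF assms] by (rule LeastI)

end

theory Submission
  imports Defs
begin

text \<open>
  The projection \<open>fst\<close> from the double cover \<open>B(G)\<close> to \<open>G\<close> sends moves to moves, and conversely a
  sequence of moves in \<open>G\<close> lifts to \<open>B(G)\<close>, step by step, from either point above its start: change
  the sheet exactly when the player really moves. Both bounds come from playing in one graph while
  imagining a game in the other.

  For \<open>c(G) \<le> c(B(G))\<close>, the cops in \<open>G\<close> lift the robber's walk to \<open>B(G)\<close>, let \<open>c(B(G))\<close> imagined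
  cops chase the lift, and play the projections of these cops. Catching the lift catches the robber.

  For \<open>c(B(G)) \<le> 2 c(G)\<close>, the cops in \<open>B(G)\<close> project the robber to \<open>G\<close>, let \<open>c(G)\<close> imagined cops
  chase the projection, and play both lifts of every imagined cop. The two lifts of one
  walk are always on opposite sheets, so together they cover the whole fibre above the imagined cop;
  when the latter catches the projected robber, one of the lifts catches the robber.

  That such an imagined game yields a strategy is the lemma \<open>cops_can_win_transfer\<close>. It requires the
  translations between the two games to be causal, because a lift depends on the past of a walk and
  not only on its current vertex.
\<close>

definition causal :: "((nat \<Rightarrow> 'a) \<Rightarrow> nat \<Rightarrow> 'b) \<Rightarrow> bool" where
  "causal F \<longleftrightarrow> (\<forall>x y t. (\<forall>s\<le>t. x s = y s) \<longrightarrow> F x t = F y t)"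

lemma causalD:
  assumes "causal F" and "\<And>s. s \<le> t \<Longrightarrow> x s = y s"
  shows "F x t = F y t"
  using assms unfolding causal_def by blast

fun response :: "(('v list \<times> 'v) list \<Rightarrow> 'v list) \<Rightarrow> (nat \<Rightarrow> 'v) \<Rightarrow> nat \<Rightarrow> 'v list" where
  "response \<sigma> r t = \<sigma> (map (\<lambda>s. (response \<sigma> r s, r s)) [0..<t])"

declare response.simps [simp del]

lemma follows_response: "follows \<sigma> (response \<sigma> r) r"
  unfolding follows_def using response.simps by blast

lemma response_cong:
  assumes "\<And>s. s < t \<Longrightarrow> r s = r' s"
  shows "response \<sigma> r t = response \<sigma> r' t"
  using assms
proof (induction t rule: less_induct)
  case (less t)
  then have "map (\<lambda>s. (response \<sigma> r s, r s)) [0..<t] = map (\<lambda>s. (response \<sigma> r' s, r' s)) [0..<t]"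
    by simp
  then show ?case
    by (metis response.simps)
qed

text \<open>
  The cops in \<open>G\<close> translate the robber's walk by \<open>\<rho>\<close> into a walk in an imagined game on \<open>H\<close>, respond
  to it by a winning strategy there, and translate the response back by \<open>\<kappa>\<close>. The imagined cops'
  position in round \<open>t\<close> depends only on the robber's positions before round \<open>t\<close>, and causality
  preserves this; so the result is a strategy in \<open>G\<close>.
\<close>

lemma cops_can_win_transfer:
  fixes \<kappa> :: "(nat \<Rightarrow> 'w list) \<Rightarrow> nat \<Rightarrow> 'v list" and \<rho> :: "(nat \<Rightarrow> 'v) \<Rightarrow> nat \<Rightarrow> 'w"
  assumes win: "cops_can_win H k"
    and causal: "causal \<kappa>" "causal \<rho>"
    and robber: "\<And>r. legal_robber G r \<Longrightarrow> legal_robber H (\<rho> r)"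
    and cops: "\<And>D. legal_cops H k D \<Longrightarrow> legal_cops G m (\<kappa> D)"
    and capture: "\<And>D r. legal_cops H k D \<Longrightarrow> captured D (\<rho> r) \<Longrightarrow> captured (\<kappa> D) r"
  shows "cops_can_win G m"
proof -
  obtain \<sigma> where \<sigma>: "\<And>D r. follows \<sigma> D r \<Longrightarrow> legal_robber H r \<Longrightarrow> legal_cops H k D \<and> captured D r"
    using win unfolding cops_can_win_def by blast
  define \<tau> where "\<tau> h = \<kappa> (response \<sigma> (\<rho> (\<lambda>s. snd (h ! s)))) (length h)" for h :: "('v list \<times> 'v) list"
  have \<tau>: "C = \<kappa> (response \<sigma> (\<rho> r))" if "follows \<tau> C r" for C r
  proof
    fix t
    let ?h = "map (\<lambda>s. (C s, r s)) [0..<t]"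
    \<comment> \<open>Beyond the recorded rounds \<open>?h ! s\<close> is arbitrary, but \<open>response\<close> does not look there.\<close>
    have "\<rho> (\<lambda>s. snd (?h ! s)) u = \<rho> r u" if "u < t" for u
      by (rule causalD[OF causal(2)]) (use that in simp)
    then have "response \<sigma> (\<rho> (\<lambda>s. snd (?h ! s))) s = response \<sigma> (\<rho> r) s" if "s \<le> t" for s
      using that by (intro response_cong) simp
    then have eq: "\<tau> ?h = \<kappa> (response \<sigma> (\<rho> r)) t"
      unfolding \<tau>_def by (auto intro: causalD[OF causal(1)])
    have "C t = \<tau> ?h"
      using that unfolding follows_def by blast
    also note eq
    finally show "C t = \<kappa> (response \<sigma> (\<rho> r)) t" .
  qed
  show ?thesis
    unfolding cops_can_win_def
  proof (intro exI[of _ \<tau>] allI impI)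
    fix C r assume "follows \<tau> C r \<and> legal_robber G r"
    then show "legal_cops G m C \<and> captured C r"
      using \<tau> \<sigma>[OF follows_response robber] cops capture by metis
  qed
qed

lemma verts_double_cover: "pverts (bipartite_double_cover G) = pverts G \<times> UNIV"
  by (simp add: bipartite_double_cover_def categorical_product_def K2_def)

lemma arcs_double_cover:
  "((v, a), (v', a')) \<in> parcs (bipartite_double_cover G) \<longleftrightarrow> (v, v') \<in> parcs G \<and> a \<noteq> a'"
  by (auto simp: bipartite_double_cover_def categorical_product_def K2_def)

lemma move_fst: "move (bipartite_double_cover G) x y \<Longrightarrow> move G (fst x) (fst y)"
  by (cases x; cases y) (auto simp: move_def arcs_double_cover)

primrec sheet :: "bool \<Rightarrow> (nat \<Rightarrow> 'v) \<Rightarrow> nat \<Rightarrow> bool" where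
  "sheet b s 0 = b"
| "sheet b s (Suc t) = (if s (Suc t) = s t then sheet b s t else \<not> sheet b s t)"

definition lift :: "bool \<Rightarrow> (nat \<Rightarrow> 'v) \<Rightarrow> nat \<Rightarrow> 'v \<times> bool" where
  "lift b s t = (s t, sheet b s t)"

lemma causal_lift: "causal (lift b)"
proof -
  have "sheet b x t = sheet b y t" if "\<forall>s\<le>t. x s = y s" for x y :: "nat \<Rightarrow> 'v" and t
    using that by (induction t) auto
  then show ?thesis
    unfolding causal_def lift_def by blast
qed

lemma move_lift:
  "move G (s t) (s (Suc t)) \<Longrightarrow> move (bipartite_double_cover G) (lift b s t) (lift b s (Suc t))"
  by (auto simp: lift_def move_def arcs_double_cover)

text \<open>The two lifts of a walk change sheets simultaneously, hence never meet.\<close>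

lemma lifts_cover_fibre: "\<exists>b. lift b s t = (s t, a)"
proof -
  have "sheet (\<not> b) s t \<longleftrightarrow> \<not> sheet b s t" for b
    by (induction t) auto
  then show ?thesis
    unfolding lift_def by (cases "sheet True s t = a") auto
qed

lemma legal_cops_length:
  assumes "legal_cops G k C"
  shows "length (C t) = k"
proof (induction t)
  case 0
  then show ?case
    using assms by (simp add: legal_cops_def)
next
  case (Suc t)
  then show ?case
    using assms list_all2_lengthD unfolding legal_cops_def by metis
qed

lemma cops_can_win_base:
  assumes "cops_can_win (bipartite_double_cover G) k"
  shows "cops_can_win G k"
proof (rule cops_can_win_transfer[OF assms,
      where \<kappa> = "\<lambda>D t. map fst (D t)" and \<rho> = "lift False"])
  show "causal (\<lambda>D t. map fst (D t :: ('a \<times> bool) list))"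
    by (simp add: causal_def)
  show "causal (lift False :: (nat \<Rightarrow> 'a) \<Rightarrow> _)"
    by (rule causal_lift)
  show "legal_robber (bipartite_double_cover G) (lift False r)" if "legal_robber G r" for r
    using that by (auto simp: legal_robber_def verts_double_cover move_lift) (simp add: lift_def)
  show "legal_cops G k (\<lambda>t. map fst (D t))" if "legal_cops (bipartite_double_cover G) k D" for D
    unfolding legal_cops_def
  proof (intro conjI allI)
    show "length (map fst (D 0)) = k" and "set (map fst (D 0)) \<subseteq> pverts G"
      using that by (auto simp: legal_cops_def verts_double_cover)
    show "list_all2 (move G) (map fst (D t)) (map fst (D (Suc t)))" for t
      using that unfolding legal_cops_def list_all2_map1 list_all2_map2
      by (metis (mono_tags, lifting) list_all2_mono move_fst)
  qed
  show "captured (\<lambda>t. map fst (D t)) r" if "captured D (lift False r)" for D r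
    using that by (force simp: captured_def lift_def)
qed

text \<open>
  The lifted cops are indexed by sheet and imagined cop, so that each entry of the list is a single
  walk. Listing the fibres over the imagined cops in a fixed order instead would not give walks:
  when a cop moves, its two lifts exchange sheets.
\<close>

lemma cops_can_win_double_cover:
  assumes "cops_can_win G k"
  shows "cops_can_win (bipartite_double_cover G) (2 * k)"
proof -
  define I where "I = List.product [False, True] [0..<k]"
  define \<kappa> where "\<kappa> D t = map (\<lambda>(b, i). lift b (\<lambda>s. D s ! i) t) I" for D :: "nat \<Rightarrow> 'a list" and t
  have I: "length I = 2 * k" "set I = UNIV \<times> {..<k}"
    by (auto simp: I_def)
  show ?thesis
  proof (rule cops_can_win_transfer[OF assms, where \<kappa> = \<kappa> and \<rho> = "\<lambda>r t. fst (r t)"])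
    show "causal \<kappa>"
      unfolding causal_def
    proof (intro allI impI)
      fix D D' :: "nat \<Rightarrow> 'a list" and t assume "\<forall>s\<le>t. D s = D' s"
      then have "lift b (\<lambda>s. D s ! i) t = lift b (\<lambda>s. D' s ! i) t" for b i
        by (intro causalD[OF causal_lift]) simp
      then show "\<kappa> D t = \<kappa> D' t"
        by (simp add: \<kappa>_def)
    qed
    show "causal (\<lambda>r t. fst (r t :: 'a \<times> bool))"
      by (simp add: causal_def)
    show "legal_robber G (\<lambda>t. fst (r t))" if "legal_robber (bipartite_double_cover G) r" for r
      using that by (auto simp: legal_robber_def verts_double_cover move_fst mem_Times_iff)
    show "legal_cops (bipartite_double_cover G) (2 * k) (\<kappa> D)" if D: "legal_cops G k D" for D
      unfolding legal_cops_def
    proof (intro conjI allI)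
      show "length (\<kappa> D 0) = 2 * k"
        by (simp add: \<kappa>_def I)
      show "set (\<kappa> D 0) \<subseteq> pverts (bipartite_double_cover G)"
        using D by (auto simp: \<kappa>_def I lift_def verts_double_cover legal_cops_def)
      show "list_all2 (move (bipartite_double_cover G)) (\<kappa> D t) (\<kappa> D (Suc t))" for t
      proof -
        have "move G (D t ! i) (D (Suc t) ! i)" if "i < k" for i
          using D that legal_cops_length[OF D]
          by (auto simp: legal_cops_def intro: list_all2_nthD)
        then show ?thesis
          by (auto simp: \<kappa>_def list_all2_map1 list_all2_map2 list_all2_same I move_lift)
      qed
    qed
    show "captured (\<kappa> D) r" if D: "legal_cops G k D" and capt: "captured D (\<lambda>t. fst (r t))" for D r
    proof -
      have "x \<in> set (\<kappa> D t)" if fst: "fst x \<in> set (D t)" for x t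
      proof -
        obtain i where i: "i < k" "D t ! i = fst x"
          using fst legal_cops_length[OF D] by (metis in_set_conv_nth)
        obtain b where "lift b (\<lambda>s. D s ! i) t = x"
          using lifts_cover_fibre[of "\<lambda>s. D s ! i" t "snd x"] i by auto
        moreover have "(b, i) \<in> set I"
          using i by (simp add: I)
        ultimately show ?thesis
          unfolding \<kappa>_def by force
      qed
      then show ?thesis
        using capt unfolding captured_def by blast
    qed
  qed
qed

theorem theorem25:
  fixes G :: "'v pair_pre_digraph"
  assumes "pair_graph G"
    and "connected (with_proj G)"
    and "\<not> bipartite G"
  shows "cop_number G \<le> cop_number (bipartite_double_cover G)
    \<and> cop_number (bipartite_double_cover G) \<le> 2 * cop_number G"
proof -
  interpret pair_graph G by fact
  have "finite (pverts G)" "finite (pverts (bipartite_double_cover G))"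
    by (simp_all add: pair_finite_verts verts_double_cover)
  then have "cops_can_win G (cop_number (bipartite_double_cover G))"
    and "cops_can_win (bipartite_double_cover G) (2 * cop_number G)"
    by (blast intro: cops_can_win_base cops_can_win_double_cover cops_can_win_cop_number)+
  then show ?thesis
    unfolding cop_number_def[of G] cop_number_def[of "bipartite_double_cover G"]
    by (simp add: Least_le)
qed

end
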